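(* Let $(S(t))_{t\ge 0}$ be a dynamical system on a complete metric space $(X,d)$. (i) If $u$ is a positive trajectory, then $u$ is periodic on $[t_0,+\infty)$ for some $t_0\ge 0$ if and only if $u(\mathbb{R}^+)$ is a compact set and $(S(t))_{t\ge 0}$ is equicontinuous on $u(\mathbb{R}^+)$. (ii) If $u$ is a complete trajectory, then $u$ is periodic if and only if $u(\mathbb{R})$ is a compact set and $(S(t))_{t\ge 0}$ is equicontinuous on $u(\mathbb{R})$. (iii) There exists a complete trajectory which is periodic if and only if there exists a positive trajectory $u$ such that $u(\mathbb{R}^+)$ is a compact set and $(S(t))_{t\ge 0}$ is equicontinuous on $u(\mathbb{R}^+)$.
   Context: $\mathbb{R}^+=[0,+\infty)$. A dynamical system (nonlinear semigroup) on a complete metric space $(X,d)$ is a family $(S(t))_{t\ge 0}$ of maps from $X$ to itself such that: each $S(t):X\to X$ is continuous; $S(0)x=x$ for all $x\in X$; $S(t+s)=S(t)\circ S(s)$ for all $s,t\ge 0$; and for each $x\in X$ the map $t\mapsto S(t)x$ is continuous from $[0,+\infty)$ to $X$. For $x\in X$, the positive trajectory of $x$ is the map $S(\cdot)x:\mathbb{R}^+\to X$, $t\mapsto S(t)x$; a positive trajectory is a map of this form for some $x\in X$. A complete trajectory is a function $u:\mathbb{R}\to X$ such that $u(t+\tau)=S(\tau)u(t)$ for all $t\in\mathbb{R}$ and $\tau\ge 0$. $(S(t))_{t\ge 0}$ is equicontinuous on a compact set $K\subset X$ if for every $\varepsilon>0$ there exists $\delta>0$ such that for all $x_1,x_2\in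 K$, $d(x_1,x_2)\le\delta$ implies $\sup_{t\ge 0}d(S(t)x_1,S(t)x_2)\le\varepsilon$. A function $u:\mathbb{R}^+\to X$ is periodic on $[t_0,+\infty)$ if there is $\omega>0$ with $u(t+\omega)=u(t)$ for all $t\ge t_0$. A function $u:\mathbb{R}\to X$ is periodic if there is $\omega>0$ with $u(t+\omega)=u(t)$ for all $t\in\mathbb{R}$. *)

theory Defs
  imports "HOL-Analysis.Analysis"
begin

text \<open>Times are reals restricted to \<open>t \<ge> 0\<close> by explicit guards: values of a semigroup or of a
  positive trajectory at negative times are irrelevant.\<close>

locale dynamical_system =
  fixes S :: "real \<Rightarrow> 'a::complete_space \<Rightarrow> 'a"
  assumes continuous_state: "t \<ge> 0 \<Longrightarrow> continuous_on UNIV (S t)"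
    and zero: "S 0 x = x"
    and semigroup: "s \<ge> 0 \<Longrightarrow> t \<ge> 0 \<Longrightarrow> S (t + s) = S t \<circ> S s"
    and continuous_time: "continuous_on {0..} (\<lambda>t. S t x)"

definition positive_trajectory :: "(real \<Rightarrow> 'a \<Rightarrow> 'a) \<Rightarrow> (real \<Rightarrow> 'a) \<Rightarrow> bool" where
  "positive_trajectory S u \<longleftrightarrow> (\<exists>x. \<forall>t\<ge>0. u t = S t x)"

definition complete_trajectory :: "(real \<Rightarrow> 'a \<Rightarrow> 'a) \<Rightarrow> (real \<Rightarrow> 'a) \<Rightarrow> bool" where
  "complete_trajectory S u \<longleftrightarrow> (\<forall>t. \<forall>\<tau>\<ge>0. u (t + \<tau>) = S \<tau> (u t))"

text \<open>The supremum is taken in the extended reals, since it may be infinite.\<close>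

definition equicontinuous_semigroup_on ::
    "(real \<Rightarrow> 'a::metric_space \<Rightarrow> 'a) \<Rightarrow> 'a set \<Rightarrow> bool" where
  "equicontinuous_semigroup_on S K \<longleftrightarrow>
     (\<forall>\<epsilon>>0. \<exists>\<delta>>0. \<forall>x1\<in>K. \<forall>x2\<in>K. dist x1 x2 \<le> \<delta> \<longrightarrow>
        (SUP t\<in>{0..}. ereal (dist (S t x1) (S t x2))) \<le> ereal \<epsilon>)"

definition periodic_from :: "real \<Rightarrow> (real \<Rightarrow> 'a) \<Rightarrow> bool" where
  "periodic_from t0 u \<longleftrightarrow> (\<exists>\<omega>>0. \<forall>t\<ge>t0. u (t + \<omega>) = u t)"

definition periodic :: "(real \<Rightarrow> 'a) \<Rightarrow> bool" where
  "periodic u \<longleftrightarrow> (\<exists>\<omega>>0. \<forall>t. u (t + \<omega>) = u t)"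

end

theory Submission
  imports Defs
begin

text \<open>A curve that is eventually periodic covers its whole image during a bounded interval of time, so
  the image is compact. On such an orbit all the semigroup does is shift the time parameter, and only
  shifts from a bounded interval matter; since \<open>(t, a) \<mapsto> u (t + a)\<close> is continuous, compactness of
  the parameter space gives equicontinuity
  (\<open>eventually_periodic_imp_compact_equicontinuous\<close>).

  For the converse, it is enough that the trajectory \<open>u\<close> passes twice through one point, as the
  semigroup law then propagates the coincidence to all later times. A double point comes from the
  Baire category theorem (\<open>recurrent_curve_self_intersects\<close>): if the image of \<open>u\<close> is compact, it
  is the countable union of the compact arcs that \<open>u\<close> describes during the intervals
  \<open>[- n, n]\<close>, so one arc contains a relatively open piece of the image; if \<open>u\<close>
  returns to that piece at arbitrarily late times, it meets the arc again.

  The recurrence that this argument requires has two sources. For a positive trajectory with compact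
  orbit, the omega-limit set lies in the orbit, so the trajectory enters it, stays
  inside, and from then on is recurrent by the definition of a limit point
  (\<open>compact_orbit_imp_eventually_periodic\<close>). For a complete trajectory, two of the
  states \<open>u (a - n h)\<close> are close together by compactness, and equicontinuity carries this
  closeness forward to time \<open>a\<close> (\<open>joint_recurrence\<close>). Two points of the orbit can be made to
  return along the same times, so two distinct points can never be
  merged by the flow (\<open>confluent_points_equal\<close>); this extends the period backwards in time to the
  whole line.

  Finally, the periodic tail of a positive trajectory extends periodically to a complete trajectory
  (\<open>periodic_extension\<close>), which gives the existence statement.\<close>

section \<open>Curves that return to themselves\<close>

text \<open>The arcs described during bounded intervals of time are countably many closed sets covering
  the compact image, so by Baire one of them is a neighbourhood of one of its points. The curve
  comes back to this neighbourhood after the arc has ended, hence meets the arc a second time.\<close>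

lemma recurrent_curve_self_intersects:
  fixes u :: "real \<Rightarrow> 'a::metric_space"
  assumes cont: "continuous_on I u" and "closed I" and "I \<noteq> {}" and comp: "compact (u ` I)"
    and recur: "\<And>t \<epsilon> T. t \<in> I \<Longrightarrow> \<epsilon> > 0 \<Longrightarrow> \<exists>r\<in>I. r \<ge> T \<and> dist (u r) (u t) < \<epsilon>"
  obtains p q where "p \<in> I" "q \<in> I" "p < q" "u p = u q"
proof -
  define A where "A n = u ` (I \<inter> {- real n..real n})" for n :: nat
  let ?X = "top_of_set (u ` I)"
  have cover: "\<Union>(range A) = u ` I"
  proof -
    have "\<exists>n::nat. t \<in> {- real n..real n}" for t :: real
      using real_arch_simple[of "\<bar>t\<bar>"] by (simp add: abs_le_iff minus_le_iff conj_commute)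
    then show ?thesis by (fastforce simp: A_def)
  qed
  have "compact (I \<inter> {- real n..real n})" for n
    using \<open>closed I\<close> by (simp add: closed_Int_compact)
  then have "compact (A n)" for n
    unfolding A_def by (meson cont compact_continuous_image continuous_on_subset inf_le1)
  then have clo: "closedin ?X (A n)" for n
    by (intro closed_subset) (auto simp: A_def compact_imp_closed)
  have "\<exists>n. ?X interior_of A n \<noteq> {}"
  proof (rule ccontr)
    assume "\<not> ?thesis"
    then have "?X interior_of \<Union>(range A) = {}"
      using clo comp
      by (intro Baire_category_alt)
        (auto simp: compact_imp_locally_compact_space compact_space_subtopology
          regular_space_subtopology metrizable_imp_regular_space metrizable_space_euclidean)
    then show False
      using cover \<open>I \<noteq> {}\<close> interior_of_topspace[of ?X] by simp
  qed
  then obtain n where "?X interior_of A n \<noteq> {}" ..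
  then obtain U y where U: "openin ?X U" "y \<in> U" "U \<subseteq> A n"
    by (auto simp: interior_of_def)
  then obtain t where t: "t \<in> I" "y = u t"
    by (auto simp: A_def)
  obtain e where e: "e > 0" "\<And>z. z \<in> u ` I \<Longrightarrow> dist z y < e \<Longrightarrow> z \<in> U"
    using U(1,2) unfolding openin_euclidean_subtopology_iff by metis
  \<comment> \<open>Every parameter of the arc \<open>A n\<close> is at most \<open>n\<close>, so a later visit is a new one.\<close>
  obtain r where r: "r \<in> I" "r \<ge> real n + 1" "dist (u r) (u t) < e"
    using recur[OF t(1) e(1)] by blast
  then have "u r \<in> A n"
    using e t U by blast
  then obtain p where "p \<in> I" "p \<le> real n" "u p = u r"
    by (auto simp: A_def)
  then show thesis
    using r by (intro that[of p r]) auto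
qed

definition omega_limit :: "(real \<Rightarrow> 'a::topological_space) \<Rightarrow> 'a set" where
  "omega_limit u = (\<Inter>T. closure (u ` {T..}))"

lemma closed_omega_limit: "closed (omega_limit u)"
  unfolding omega_limit_def by blast

lemma omega_limit_meets_compact:
  fixes u :: "real \<Rightarrow> 'a::metric_space"
  assumes "compact K" "\<And>t. t \<ge> t0 \<Longrightarrow> u t \<in> K"
  shows "omega_limit u \<inter> K \<noteq> {}"
proof -
  have "\<forall>n. u (t0 + real n) \<in> K"
    using assms(2) by simp
  then obtain l and f :: "nat \<Rightarrow> nat" where l: "l \<in> K" "strict_mono f"
    and lim: "(\<lambda>n. u (t0 + real (f n))) \<longlonglongrightarrow> l"
    using seq_compactE[OF assms(1)[unfolded compact_eq_seq_compact_metric], of "\<lambda>n. u (t0 + real n)"]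
    by (auto simp: o_def)
  have "l \<in> closure (u ` {T..})" for T
  proof (rule Lim_in_closed_set[OF closed_closure _ _ lim])
    obtain N :: nat where N: "real N \<ge> T - t0"
      using real_arch_simple by blast
    have "T \<le> t0 + real (f n)" if "n \<ge> N" for n
      using that N seq_suble[OF l(2), of n] by linarith
    then show "\<forall>\<^sub>F n in sequentially. u (t0 + real (f n)) \<in> closure (u ` {T..})"
      unfolding eventually_sequentially by (meson closure_subset image_eqI subsetD atLeast_iff)
  qed simp
  then show ?thesis
    using l by (auto simp: omega_limit_def)
qed

section \<open>Eventually periodic curves\<close>

lemma eventually_periodic_add:
  fixes u :: "real \<Rightarrow> 'a"
  assumes "\<And>t. t \<ge> t0 \<Longrightarrow> u (t + \<omega>) = u t" "\<omega> \<ge> 0" "t \<ge> t0"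
  shows "u (t + real n * \<omega>) = u t"
proof (induction n)
  case (Suc n)
  have "u (t + real (Suc n) * \<omega>) = u ((t + real n * \<omega>) + \<omega>)"
    by (simp add: algebra_simps)
  also have "\<dots> = u (t + real n * \<omega>)"
    using assms by (intro assms(1)) (simp add: add_increasing2)
  finally show ?case using Suc by simp
qed simp

text \<open>A late time is moved by whole periods into the window \<open>[t0, t0 + \<omega>]\<close>. The multiple of the
  period is a natural number, because the periodicity of an eventually periodic curve can only be
  iterated forwards from \<open>t0\<close>.\<close>

lemma reduce_time:
  fixes t t0 \<omega> :: real
  assumes "\<omega> > 0" "t \<ge> t0"
  obtains n :: nat and s where "t = s + real n * \<omega>" "t0 \<le> s" "s \<le> t0 + \<omega>"
proof
  let ?n = "nat \<lfloor>(t - t0) / \<omega>\<rfloor>"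
  have n: "real ?n = of_int \<lfloor>(t - t0) / \<omega>\<rfloor>"
    using assms by simp
  have "real ?n \<le> (t - t0) / \<omega>" "(t - t0) / \<omega> \<le> real ?n + 1"
    unfolding n by linarith+
  then have "real ?n * \<omega> \<le> t - t0" "t - t0 \<le> (real ?n + 1) * \<omega>"
    using assms(1) by (simp_all only: pos_le_divide_eq pos_divide_le_eq)
  then show "t0 \<le> t - real ?n * \<omega>" "t - real ?n * \<omega> \<le> t0 + \<omega>"
    by (simp_all add: distrib_right)
  show "t = (t - real ?n * \<omega>) + real ?n * \<omega>" by simp
qed

lemma eventually_periodic_orbit:
  fixes u :: "real \<Rightarrow> 'a"
  assumes "\<omega> > 0" "t0 \<ge> 0" "\<And>t. t \<ge> t0 \<Longrightarrow> u (t + \<omega>) = u t"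
  shows "u ` {0..} = u ` {0..t0 + \<omega>}"
proof
  show "u ` {0..} \<subseteq> u ` {0..t0 + \<omega>}"
  proof (rule image_subsetI)
    fix t :: real assume "t \<in> {0..}"
    show "u t \<in> u ` {0..t0 + \<omega>}"
    proof (cases "t \<ge> t0")
      case True
      then obtain n s where "t = s + real n * \<omega>" "t0 \<le> s" "s \<le> t0 + \<omega>"
        using reduce_time assms(1) by blast
      moreover from this have "u t = u s"
        using eventually_periodic_add[of t0 u \<omega> s n] assms by simp
      ultimately show ?thesis using assms(2) by auto
    qed (use \<open>t \<in> {0..}\<close> assms in auto)
  qed
qed auto

lemma periodic_image_nonneg:
  assumes "periodic u"
  shows "u ` {0..} = range u"
proof -
  obtain \<omega> where om: "\<omega> > 0" "\<And>t. u (t + \<omega>) = u t"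
    using assms by (auto simp: periodic_def)
  have "u t \<in> u ` {0..}" for t
  proof -
    obtain n :: nat where "- t \<le> real n * \<omega>"
      using reals_Archimedean3[OF om(1)] less_imp_le by blast
    then show ?thesis
      using eventually_periodic_add[of t u \<omega> t n] om by (intro image_eqI[of _ _ "t + real n * \<omega>"]) auto
  qed
  then show ?thesis by auto
qed

section \<open>Orbits of the semigroup\<close>

lemma equicontinuous_semigroup_on_iff:
  "equicontinuous_semigroup_on S K \<longleftrightarrow>
     (\<forall>\<epsilon>>0. \<exists>\<delta>>0. \<forall>x\<in>K. \<forall>y\<in>K. dist x y \<le> \<delta> \<longrightarrow> (\<forall>t\<ge>0. dist (S t x) (S t y) \<le> \<epsilon>))"
  unfolding equicontinuous_semigroup_on_def by (simp add: SUP_le_iff Ball_def)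

context dynamical_system
begin

lemma positive_trajectory_step:
  assumes "positive_trajectory S u" "t \<ge> 0" "\<tau> \<ge> 0"
  shows "u (t + \<tau>) = S \<tau> (u t)"
proof -
  obtain x where "\<forall>t\<ge>0. u t = S t x"
    using assms(1) by (auto simp: positive_trajectory_def)
  then show ?thesis
    using assms(2,3) semigroup[of t \<tau>] by (simp add: add.commute)
qed

lemma positive_trajectory_continuous:
  assumes "positive_trajectory S u"
  shows "continuous_on {0..} u"
proof -
  obtain x where "\<forall>t\<ge>0. u t = S t x"
    using assms by (auto simp: positive_trajectory_def)
  then show ?thesis
    by (intro continuous_on_eq[OF continuous_time[of x]]) simp
qed

lemma complete_trajectory_shift:
  assumes "complete_trajectory S u"
  shows "positive_trajectory S (\<lambda>t. u (a + t))"
  using assms unfolding positive_trajectory_def complete_trajectory_def by blast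

text \<open>Continuity of orbits is one-sided at their initial time, so continuity at \<open>t\<close> is read off from
  the orbit that starts one unit of time earlier.\<close>

lemma complete_trajectory_continuous:
  assumes "complete_trajectory S u"
  shows "continuous_on UNIV u"
proof -
  have "isCont u t" for t
  proof -
    have "continuous_on {0..} (\<lambda>s. u (t - 1 + s))"
      by (rule positive_trajectory_continuous[OF complete_trajectory_shift[OF assms]])
    then have "continuous_on {t - 1..} (\<lambda>s. u (t - 1 + (s - (t - 1))))"
      by (rule continuous_on_compose2) (auto intro!: continuous_intros)
    then have "continuous_on {t - 1..} u"
      by simp
    then show ?thesis
      by (rule continuous_on_interior) (simp add: interior_Ici[of "t - 2"])
  qed
  then show ?thesis
    by (simp add: continuous_at_imp_continuous_on)
qed

lemma periodic_from_collision:
  assumes "positive_trajectory S u" "0 \<le> p" "p < q" "u p = u q"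
  shows "periodic_from p u"
  unfolding periodic_from_def
proof (intro exI[of _ "q - p"] conjI allI impI)
  fix t assume "t \<ge> p"
  then show "u (t + (q - p)) = u t"
    using positive_trajectory_step[OF assms(1), of p "t - p"]
      positive_trajectory_step[OF assms(1), of q "t - p"] assms by (simp add: algebra_simps)
qed (use assms in simp)

text \<open>A compact orbit contains limit points of the trajectory. The times \<open>I\<close> at which the trajectory
  is in its omega-limit set form a closed set that contains all times after any of its members, and
  the trajectory, restricted to \<open>I\<close>, is recurrent and has the omega-limit points in the orbit
  as its compact image.\<close>

lemma compact_orbit_imp_eventually_periodic:
  assumes u: "positive_trajectory S u" and comp: "compact (u ` {0..})"
  shows "\<exists>t0\<ge>0. periodic_from t0 u"
proof -
  let ?L = "omega_limit u"
  define I where "I = {0..} \<inter> u -` ?L"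
  have cont: "continuous_on {0..} u"
    by (rule positive_trajectory_continuous[OF u])
  have I_image: "u ` I = u ` {0..} \<inter> ?L"
    by (auto simp: I_def)
  have nonempty: "I \<noteq> {}"
    using omega_limit_meets_compact[OF comp, of 0 u] I_image by auto
  have closed: "closed I"
    unfolding I_def by (rule continuous_closed_preimage[OF cont closed_atLeast closed_omega_limit])
  have compI: "compact (u ` I)"
    unfolding I_image by (rule compact_Int_closed[OF comp closed_omega_limit])
  have invariant: "S \<tau> y \<in> ?L" if "y \<in> ?L" "\<tau> \<ge> 0" for y \<tau>
    unfolding omega_limit_def
  proof
    fix T
    \<comment> \<open>Negative times carry no information on \<open>u\<close>, hence the tail is cut off at \<open>0\<close>.\<close>
    have "S \<tau> ` (u ` {max T 0..}) \<subseteq> u ` {T..}"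
      using positive_trajectory_step[OF u, of _ \<tau>, symmetric] \<open>\<tau> \<ge> 0\<close> by (auto intro!: imageI)
    then have "S \<tau> ` closure (u ` {max T 0..}) \<subseteq> closure (u ` {T..})"
      using closure_subset[of "u ` {T..}"] continuous_state[OF \<open>\<tau> \<ge> 0\<close>]
      by (intro image_closure_subset) (blast intro: continuous_on_subset | simp)+
    then show "S \<tau> y \<in> closure (u ` {T..})"
      using that(1) by (auto simp: omega_limit_def)
  qed
  have I_up: "r \<in> I" if "t \<in> I" "r \<ge> t" for t r
    using positive_trajectory_step[OF u, of t "r - t"] invariant[of "u t" "r - t"] that
    by (auto simp: I_def)
  have recur: "\<exists>r\<in>I. r \<ge> T \<and> dist (u r) (u t) < \<epsilon>" if "t \<in> I" "\<epsilon> > 0" for t \<epsilon> T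
  proof -
    have "u t \<in> closure (u ` {max T t..})"
      using that by (auto simp: I_def omega_limit_def)
    then obtain r where "r \<ge> max T t" "dist (u r) (u t) < \<epsilon>"
      using \<open>\<epsilon> > 0\<close> unfolding closure_approachable by blast
    then show ?thesis
      using I_up[OF that(1)] by auto
  qed
  obtain p q where "p \<in> I" "p < q" "u p = u q"
    using recurrent_curve_self_intersects[OF continuous_on_subset[OF cont] closed nonempty compI recur]
    by (auto simp: I_def)
  then show ?thesis
    using periodic_from_collision[OF u, of p q] by (auto simp: I_def)
qed

text \<open>Writing \<open>x = u a\<close> and \<open>y = u b\<close> turns \<open>S t x\<close> and \<open>S t y\<close> into \<open>u (t + a)\<close> and \<open>u (t + b)\<close>, where
  \<open>a\<close>, \<open>b\<close> and \<open>t\<close> may be taken from a bounded interval. This replaces joint continuity of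
  \<open>S\<close> in time and state by the continuity of the single curve \<open>u\<close>.\<close>

lemma eventually_periodic_imp_compact_equicontinuous:
  assumes u: "positive_trajectory S u" and "t0 \<ge> 0" "periodic_from t0 u"
  shows "compact (u ` {0..})" "equicontinuous_semigroup_on S (u ` {0..})"
proof -
  obtain \<omega> where om: "\<omega> > 0" "\<And>t. t \<ge> t0 \<Longrightarrow> u (t + \<omega>) = u t"
    using assms(3) by (auto simp: periodic_from_def)
  define M where "M = t0 + \<omega>"
  have orbit: "u ` {0..} = u ` {0..M}"
    unfolding M_def using om assms(2) by (intro eventually_periodic_orbit)
  have cont: "continuous_on {0..} u"
    by (rule positive_trajectory_continuous[OF u])
  then show "compact (u ` {0..})"
    unfolding orbit by (intro compact_continuous_image) (auto intro: continuous_on_subset)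
  have contc: "continuous_on X (\<lambda>z. u (f z))"
    if "continuous_on X f" "\<And>z. z \<in> X \<Longrightarrow> f z \<ge> 0" for X and f :: "real \<times> real \<times> real \<Rightarrow> real"
    by (rule continuous_on_compose2[OF cont that(1)]) (use that(2) in blast)
  show "equicontinuous_semigroup_on S (u ` {0..})"
    unfolding equicontinuous_semigroup_on_iff
  proof (intro allI impI)
    fix \<epsilon> :: real assume "\<epsilon> > 0"
    \<comment> \<open>\<open>C\<close> is the compact set of bad parameters. The distance of the initial states is positive on it,
      because equal states have equal futures, so it is bounded below there.\<close>
    let ?B = "{0..M} \<times> {0..M} \<times> {0..M}"
    define C where "C = ?B \<inter> (\<lambda>(t, a, b). dist (u (t + a)) (u (t + b))) -` {\<epsilon>..}"
    have "closed C"
      unfolding C_def split_def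
      by (rule continuous_closed_preimage)
        (auto intro!: continuous_intros contc closed_Times)
    then have "compact (?B \<inter> C)"
      by (intro compact_Int_closed compact_Times compact_Icc)
    then have "compact C"
      by (simp add: C_def)
    have pos: "dist (u a) (u b) > 0" if "(t, a, b) \<in> C" for t a b
    proof -
      have "u (t + a) = S t (u a)" "u (t + b) = S t (u b)"
        using positive_trajectory_step[OF u] that by (auto simp: C_def add.commute)
      then show ?thesis
        using that \<open>\<epsilon> > 0\<close> by (auto simp: C_def)
    qed
    obtain \<delta> where \<delta>: "\<delta> > 0" "\<And>t a b. (t, a, b) \<in> C \<Longrightarrow> dist (u a) (u b) > \<delta>"
    proof (cases "C = {}")
      case False
      have "continuous_on C (\<lambda>(t, a, b). dist (u a) (u b))"
        unfolding split_def by (auto intro!: continuous_intros contc simp: C_def)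
      then obtain z where "z \<in> C" "\<forall>w\<in>C. (\<lambda>(t, a, b). dist (u a) (u b)) z \<le> (\<lambda>(t, a, b). dist (u a) (u b)) w"
        using continuous_attains_inf[OF \<open>compact C\<close> False] by blast
      moreover obtain t a b where "z = (t, a, b)" by (cases z)
      ultimately have "(t, a, b) \<in> C" "\<And>t' a' b'. (t', a', b') \<in> C \<Longrightarrow> dist (u a) (u b) \<le> dist (u a') (u b')"
        by auto
      then have "dist (u a) (u b) > 0"
        "\<And>t' a' b'. (t', a', b') \<in> C \<Longrightarrow> dist (u a) (u b) / 2 < dist (u a') (u b')"
        using pos by (blast, smt (verit) field_sum_of_halves pos)
      then show thesis
        by (intro that[of "dist (u a) (u b) / 2"]) auto
    qed (use that[of 1] in auto)
    have "dist (S t (u a)) (S t (u b)) \<le> \<epsilon>"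
      if ab: "a \<in> {0..M}" "b \<in> {0..M}" "dist (u a) (u b) \<le> \<delta>" and "t \<ge> 0" for t a b
    proof -
      obtain s where s: "s \<in> {0..M}" "u (a + t) = u (s + a)" "u (b + t) = u (s + b)"
      proof (cases "t \<ge> t0")
        case True
        then obtain n s where ns: "t = s + real n * \<omega>" "t0 \<le> s" "s \<le> t0 + \<omega>"
          using reduce_time om(1) by blast
        have "u (c + t) = u (s + c)" if "c \<ge> 0" for c
          using eventually_periodic_add[of t0 u \<omega> "s + c" n] om ns that by (simp add: add_ac)
        then show thesis
          using that[of s] ns ab assms(2) by (auto simp: M_def)
      next
        case False
        then show thesis
          using that[of t] om(1) \<open>t \<ge> 0\<close> by (auto simp: M_def add.commute)
      qed
      have "(s, a, b) \<notin> C"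
        using \<delta>(2) ab by force
      then have "dist (u (s + a)) (u (s + b)) \<le> \<epsilon>"
        using s(1) ab by (auto simp: C_def)
      then show ?thesis
        using s positive_trajectory_step[OF u] ab \<open>t \<ge> 0\<close> by (metis atLeastAtMost_iff)
    qed
    then show "\<exists>\<delta>>0. \<forall>x\<in>u ` {0..}. \<forall>y\<in>u ` {0..}. dist x y \<le> \<delta> \<longrightarrow> (\<forall>t\<ge>0. dist (S t x) (S t y) \<le> \<epsilon>)"
      unfolding orbit using \<delta>(1) by blast
  qed
qed

section \<open>Complete trajectories\<close>

text \<open>Along a convergent subsequence of the pairs \<open>(u (a - n h), u (b - n h))\<close> two pairs, with indices
  \<open>m < n\<close>, are close. Applying \<open>S (n h)\<close> to both turns the states with index \<open>n\<close> into \<open>u a\<close> and \<open>u b\<close>, and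
  those with index \<open>m\<close> into \<open>S r (u a)\<close> and \<open>S r (u b)\<close> with \<open>r = (n - m) h\<close>. Treating the two points
  as one pair makes the return time \<open>r\<close> common to both.\<close>

lemma joint_recurrence:
  assumes u: "complete_trajectory S u" and comp: "compact (range u)"
    and equi: "equicontinuous_semigroup_on S (range u)" and "\<epsilon> > 0"
  obtains r where "r \<ge> T" "r \<ge> 0" "dist (S r (u a)) (u a) \<le> \<epsilon>" "dist (S r (u b)) (u b) \<le> \<epsilon>"
proof -
  obtain \<delta> where \<delta>: "\<delta> > 0"
    "\<And>x y t. x \<in> range u \<Longrightarrow> y \<in> range u \<Longrightarrow> dist x y \<le> \<delta> \<Longrightarrow> t \<ge> 0 \<Longrightarrow> dist (S t x) (S t y) \<le> \<epsilon>"
    using equi \<open>\<epsilon> > 0\<close> unfolding equicontinuous_semigroup_on_iff by metis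
  define h where "h = max T 0"
  define z where "z n = (u (a - real n * h), u (b - real n * h))" for n :: nat
  have "\<forall>n. z n \<in> range u \<times> range u"
    by (auto simp: z_def)
  then obtain l and f :: "nat \<Rightarrow> nat" where f: "strict_mono f" "(z \<circ> f) \<longlonglongrightarrow> l"
    using seq_compactE[OF compact_Times[OF comp comp, unfolded compact_eq_seq_compact_metric]] by metis
  then have "Cauchy (z \<circ> f)"
    by (simp add: LIMSEQ_imp_Cauchy)
  then obtain N where N: "dist (z (f N)) (z (f (Suc N))) < \<delta>"
    unfolding Cauchy_def using \<delta>(1) by (metis comp_apply le_refl le_SucI)
  define m n where "m = f N" and "n = f (Suc N)"
  have "m < n"
    using f(1) by (simp add: m_def n_def strict_mono_less)
  define r where "r = (real n - real m) * h"
  have "h \<le> r"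
  proof -
    have "1 * h \<le> (real n - real m) * h"
      using \<open>m < n\<close> by (intro mult_right_mono) (auto simp: h_def)
    then show ?thesis by (simp add: r_def)
  qed
  then have "r \<ge> T" "r \<ge> 0"
    by (auto simp: h_def)
  have step: "u (s + \<tau>) = S \<tau> (u s)" if "\<tau> \<ge> 0" for s \<tau>
    using u that by (simp add: complete_trajectory_def)
  have return: "dist (S r (u c)) (u c) \<le> \<epsilon>"
    if close: "dist (u (c - real m * h)) (u (c - real n * h)) \<le> \<delta>" for c
  proof -
    have nh: "real n * h \<ge> 0"
      by (simp add: h_def)
    have "S (real n * h) (u (c - real m * h)) = u (c + r)"
      using step[OF nh, of "c - real m * h"] by (simp add: r_def algebra_simps)
    moreover have "S (real n * h) (u (c - real n * h)) = u c"
      using step[OF nh, of "c - real n * h"] by simp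
    moreover have "u (c + r) = S r (u c)"
      using step[OF \<open>r \<ge> 0\<close>] .
    ultimately show ?thesis
      using \<delta>(2)[OF _ _ close nh] by simp
  qed
  have "dist (u (a - real m * h)) (u (a - real n * h)) \<le> \<delta>"
    "dist (u (b - real m * h)) (u (b - real n * h)) \<le> \<delta>"
    using N dist_fst_le[of "z m" "z n"] dist_snd_le[of "z m" "z n"]
    by (auto simp: z_def m_def n_def)
  then show thesis
    using that[OF \<open>r \<ge> T\<close> \<open>r \<ge> 0\<close>] return by blast
qed

text \<open>At a common late return time the images of the two points coincide, while each image is close to
  the point itself.\<close>

lemma confluent_points_equal:
  assumes u: "complete_trajectory S u" and comp: "compact (range u)"
    and equi: "equicontinuous_semigroup_on S (range u)"
    and merge: "\<And>t. t \<ge> T \<Longrightarrow> S t (u a) = S t (u b)"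
  shows "u a = u b"
proof -
  have "dist (u a) (u b) \<le> \<epsilon>" if "\<epsilon> > 0" for \<epsilon>
  proof -
    have "\<epsilon>/2 > 0" using that by simp
    then obtain r where r: "r \<ge> T" "dist (S r (u a)) (u a) \<le> \<epsilon>/2" "dist (S r (u b)) (u b) \<le> \<epsilon>/2"
      by (rule joint_recurrence[OF u comp equi])
    then show ?thesis
      using merge[OF r(1)] dist_triangle3[of "u a" "u b" "S r (u a)"] by simp
  qed
  then show ?thesis
    by (metis dist_le_zero_iff field_le_epsilon add_0)
qed

text \<open>A double point \<open>u p = u q\<close> gives the period \<open>q - p\<close> at times after \<open>p\<close>. At an earlier time \<open>t\<close>, the
  states \<open>u t\<close> and \<open>u (t + (q - p))\<close> have the same image once \<open>p\<close> is passed, so they are equal.\<close>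

lemma compact_equicontinuous_imp_periodic:
  assumes u: "complete_trajectory S u" and comp: "compact (range u)"
    and equi: "equicontinuous_semigroup_on S (range u)"
  shows "periodic u"
proof -
  have step: "u (s + \<tau>) = S \<tau> (u s)" if "\<tau> \<ge> 0" for s \<tau>
    using u that by (simp add: complete_trajectory_def)
  have recur: "\<exists>r\<in>UNIV. r \<ge> T \<and> dist (u r) (u t) < \<epsilon>" if "\<epsilon> > 0" for t \<epsilon> T
  proof -
    have "\<epsilon>/2 > 0" using that by simp
    then obtain r where "r \<ge> T - t" "r \<ge> 0" "dist (S r (u t)) (u t) \<le> \<epsilon>/2"
      by (rule joint_recurrence[OF u comp equi])
    then show ?thesis
      using step[of r t] \<open>\<epsilon> > 0\<close> by (intro bexI[of _ "t + r"]) auto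
  qed
  obtain p q where pq: "p < q" "u p = u q"
    using recurrent_curve_self_intersects[OF complete_trajectory_continuous[OF u] closed_UNIV
        UNIV_not_empty comp recur] by auto
  have "u (t + (q - p)) = u t" for t
  proof (rule confluent_points_equal[OF u comp equi])
    fix \<tau> assume "\<tau> \<ge> max 0 (p - t)"
    then have \<tau>: "\<tau> \<ge> 0" "\<tau> + t - p \<ge> 0" by auto
    have "S \<tau> (u (t + (q - p))) = u (q + (\<tau> + t - p))"
      using step[OF \<tau>(1), of "t + (q - p)"] by (simp add: algebra_simps)
    also have "\<dots> = u (p + (\<tau> + t - p))"
      by (simp only: step[OF \<tau>(2)] pq(2))
    also have "\<dots> = S \<tau> (u t)"
      using step[OF \<tau>(1), of t] by (simp add: algebra_simps)
    finally show "S \<tau> (u (t + (q - p))) = S \<tau> (u t)" .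
  qed
  then show ?thesis
    using pq unfolding periodic_def by (intro exI[of _ "q - p"]) auto
qed

text \<open>The loop \<open>u ` {t0..t0 + \<omega>}\<close> is traversed for ever in both directions of time. For the
  trajectory law, \<open>v\<close> near a given time is compared with \<open>u\<close> after a shift by an integer multiple
  of the period that makes the time nonnegative.\<close>

lemma periodic_extension:
  assumes u: "positive_trajectory S u" and "t0 \<ge> 0" "periodic_from t0 u"
  obtains v where "complete_trajectory S v" "periodic v"
proof -
  obtain \<omega> where om: "\<omega> > 0" "\<And>t. t \<ge> t0 \<Longrightarrow> u (t + \<omega>) = u t"
    using assms(3) by (auto simp: periodic_from_def)
  define v where "v t = u (t0 + frac (t / \<omega>) * \<omega>)" for t
  have v_eq: "v t = u (t0 + s)" if "s \<ge> 0" "s = t + of_int k * \<omega>" for s t k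
  proof -
    have "frac (t / \<omega>) = frac (s / \<omega>)"
      using om(1) that(2) by (simp add: add_divide_distrib frac_def)
    moreover have "s = frac (s / \<omega>) * \<omega> + real (nat \<lfloor>s / \<omega>\<rfloor>) * \<omega>"
      using om(1) that(1) by (simp add: frac_def left_diff_distrib)
    moreover have "frac (s / \<omega>) * \<omega> \<ge> 0"
      using om(1) by simp
    ultimately show ?thesis
      using eventually_periodic_add[of t0 u \<omega> "t0 + frac (s / \<omega>) * \<omega>" "nat \<lfloor>s / \<omega>\<rfloor>"] om
      by (simp add: v_def add.assoc)
  qed
  have "complete_trajectory S v"
    unfolding complete_trajectory_def
  proof (intro allI impI)
    fix t \<tau> :: real assume "\<tau> \<ge> 0"
    define s where "s = t + of_int (- \<lfloor>t / \<omega>\<rfloor>) * \<omega>"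
    have "s = frac (t / \<omega>) * \<omega>"
      using om(1) by (simp add: s_def frac_def left_diff_distrib)
    then have "s \<ge> 0"
      using om(1) by simp
    have "v (t + \<tau>) = u (t0 + (s + \<tau>))"
      by (rule v_eq[where k = "- \<lfloor>t / \<omega>\<rfloor>"]) (use \<open>s \<ge> 0\<close> \<open>\<tau> \<ge> 0\<close> in \<open>auto simp: s_def\<close>)
    also have "\<dots> = S \<tau> (u (t0 + s))"
      using positive_trajectory_step[OF u, of "t0 + s" \<tau>] \<open>s \<ge> 0\<close> \<open>\<tau> \<ge> 0\<close> assms(2)
      by (simp add: add.assoc)
    also have "u (t0 + s) = v t"
      by (rule v_eq[symmetric, OF \<open>s \<ge> 0\<close> s_def])
    finally show "v (t + \<tau>) = S \<tau> (v t)" .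
  qed
  moreover have "periodic v"
    unfolding periodic_def using om(1)
    by (intro exI[of _ \<omega>]) (simp add: v_def add_divide_distrib frac_def)
  ultimately show thesis by (rule that)
qed

section \<open>Characterisations of periodicity\<close>

lemma positive_trajectory_eventually_periodic_iff:
  assumes "positive_trajectory S u"
  shows "(\<exists>t0\<ge>0. periodic_from t0 u) \<longleftrightarrow>
    compact (u ` {0..}) \<and> equicontinuous_semigroup_on S (u ` {0..})"
  using eventually_periodic_imp_compact_equicontinuous[OF assms]
    compact_orbit_imp_eventually_periodic[OF assms] by blast

lemma periodic_complete_trajectory_restrict:
  assumes "complete_trajectory S u" "periodic u"
  shows "positive_trajectory S u" "compact (u ` {0..})" "equicontinuous_semigroup_on S (u ` {0..})"
proof -
  show pos: "positive_trajectory S u"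
    using complete_trajectory_shift[OF assms(1), of 0] by simp
  have "periodic_from 0 u"
    using assms(2) by (auto simp: periodic_def periodic_from_def)
  then show "compact (u ` {0..})" "equicontinuous_semigroup_on S (u ` {0..})"
    using eventually_periodic_imp_compact_equicontinuous[OF pos order_refl] by blast+
qed

lemma complete_trajectory_periodic_iff:
  assumes "complete_trajectory S u"
  shows "periodic u \<longleftrightarrow> compact (range u) \<and> equicontinuous_semigroup_on S (range u)"
  using periodic_complete_trajectory_restrict[OF assms] periodic_image_nonneg
    compact_equicontinuous_imp_periodic[OF assms] by metis

lemma ex_periodic_complete_trajectory_iff:
  "(\<exists>u. complete_trajectory S u \<and> periodic u) \<longleftrightarrow>
    (\<exists>u. positive_trajectory S u \<and>
       compact (u ` {0..}) \<and> equicontinuous_semigroup_on S (u ` {0..}))"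
  using periodic_complete_trajectory_restrict periodic_extension
    positive_trajectory_eventually_periodic_iff by metis

end

theorem corollary5p4:
  fixes S :: "real \<Rightarrow> 'a::complete_space \<Rightarrow> 'a"
  assumes "dynamical_system S"
  shows "(\<forall>u. positive_trajectory S u \<longrightarrow>
            ((\<exists>t0\<ge>0. periodic_from t0 u) \<longleftrightarrow>
             compact (u ` {0..}) \<and> equicontinuous_semigroup_on S (u ` {0..})))
       \<and> (\<forall>u. complete_trajectory S u \<longrightarrow>
            (periodic u \<longleftrightarrow>
             compact (range u) \<and> equicontinuous_semigroup_on S (range u)))
       \<and> ((\<exists>u. complete_trajectory S u \<and> periodic u) \<longleftrightarrow>
          (\<exists>u. positive_trajectory S u \<and>
             compact (u ` {0..}) \<and> equicontinuous_semigroup_on S (u ` {0..})))"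
proof -
  interpret dynamical_system S by fact
  show ?thesis
    using positive_trajectory_eventually_periodic_iff complete_trajectory_periodic_iff
      ex_periodic_complete_trajectory_iff by blast
qed

end
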